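(* Let $G$ be any group. Then the Property R graph $T_G$ is a union of disjoint copies of the looped stars $\mathcal{S}_j$, for various values of $j\in\mathbb{N}$, and isolated points. If $\mathcal{S}_{-1}$ is defined to be an isolated point, then the isomorphism type of the graph $T_G$ is encoded in one list of numbers, $\{j : \mathcal{S}_j\subset T_G,\ j\geq -1\}$, counted with multiplicity, where $\mathcal{S}_j\subset T_G$ means that $\mathcal{S}_j$ occurs as one of the disjoint pieces of this union.
   Context: For a group $H$, $H'=[H,H]$ is the derived subgroup. For a normal subgroup $N$ of $G$, $Q(G,N)$ is the preimage of $[G/N,G/N]$ under the quotient map $G\to G/N$. The Property R graph $T_G$ is the directed graph (self-loops allowed) whose vertices are the normal subgroups of $G$, with a directed edge $N_1\to N_2$ if and only if $N_2=Q(G,N_1)$. For $n\in\mathbb{N}=\{0,1,2,\dots\}$, the $n$-star graph $S_n$ is the tree on $n+1$ nodes with one node (the center) having vertex degree $n$ and the others having degree 1; $\mathcal{S}_n$ is $S_n$ modified by the addition of a self-loop at the center, and as a directed graph its other edges are directed from the leaves to the center. Thus $\mathcal{S}_0$ is a single vertex with a self-loop. An isolated point is a single vertex with no edges.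
   Formalization: For infinite groups a star may have infinitely many leaves (e.g. an infinite direct sum of copies of A_5), so for arbitrary G the index j may be an infinite cardinal; with j a natural number or -1 the decomposition is claimed when all in-degrees of T_G are finite. *)

theory Defs
  imports
    "HOL-Algebra.Algebra"
    "HOL-Library.Disjoint_Sets"
    "HOL-Library.Equipollence"
    "Graph_Theory.Pair_Digraph"
    "Graph_Theory.Digraph_Isomorphism"
begin

definition Q :: "('a, 'm) monoid_scheme \<Rightarrow> 'a set \<Rightarrow> 'a set" where
  "Q G N = {x \<in> carrier G. N #>\<^bsub>G\<^esub> x \<in> derived (G Mod N) (carrier (G Mod N))}"

definition property_R_graph :: "('a, 'm) monoid_scheme \<Rightarrow> 'a set pair_pre_digraph" where
  "property_R_graph G =
     \<lparr> pverts = {N. N \<lhd> G},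
       parcs = {(N\<^sub>1, N\<^sub>2). N\<^sub>1 \<lhd> G \<and> N\<^sub>2 \<lhd> G \<and> N\<^sub>2 = Q G N\<^sub>1} \<rparr>"

text \<open>
  The center of a looped star is \<^term>\<open>None\<close>; the leaves are the vertices \<^term>\<open>Some l\<close>.
  A property R graph of an infinite group may have vertices of infinite in-degree (take an
  infinite direct sum of copies of a nonabelian simple group: all its infinitely many normal
  subgroups point to the whole group), so the leaves form an arbitrary set, and the number of
  leaves is the cardinality of that set.
\<close>
definition looped_star :: "'i set \<Rightarrow> 'i option pair_pre_digraph" where
  "looped_star J =
     \<lparr> pverts = insert None (Some ` J),
       parcs = insert (None, None) ((\<lambda>l. (Some l, None)) ` J) \<rparr>"

definition isolated_point :: "'i option pair_pre_digraph" where
  "isolated_point = \<lparr> pverts = {None}, parcs = {} \<rparr>"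

text \<open>
  Two systems of indices for the pieces. In the first, \<^term>\<open>Some J\<close> is the index ``number of
  elements of \<open>J\<close>'' and \<^term>\<open>None\<close> plays the role of \<open>-1\<close>; equipollent \<open>J\<close> give isomorphic
  graphs, so an index stands for a cardinal. In the second the indices are the integers
  \<open>j \<ge> -1\<close>.
\<close>
definition cstar :: "'i set option \<Rightarrow> 'i option pair_pre_digraph" where
  "cstar k = (case k of None \<Rightarrow> isolated_point | Some J \<Rightarrow> looped_star J)"

definition zstar :: "int \<Rightarrow> nat option pair_pre_digraph" where
  "zstar j = (if j = -1 then isolated_point else looped_star {..<nat j})"

text \<open>
  The digraph \<open>D\<close> is the union of the disjoint subgraphs on the vertex sets in \<open>\<P>\<close>, with no
  arcs between different ones, and each of them is a copy of some \<open>S i\<close> with \<open>i \<in> I\<close>.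
\<close>
definition disjoint_copies ::
    "('i \<Rightarrow> 'w pair_pre_digraph) \<Rightarrow> 'i set \<Rightarrow> 'v pair_pre_digraph \<Rightarrow> 'v set set \<Rightarrow> bool" where
  "disjoint_copies S I D \<P> \<longleftrightarrow>
     partition_on (pverts D) \<P> \<and>
     (\<forall>(u, v) \<in> parcs D. \<exists>P\<in>\<P>. u \<in> P \<and> v \<in> P) \<and>
     (\<forall>P\<in>\<P>. \<exists>i\<in>I. digraph_iso (with_proj (S i)) (with_proj D \<restriction> P))"

text \<open>
  The cardinality of \<open>pieces S D \<P> i\<close> is the multiplicity of \<open>i\<close> in the list attached to the
  decomposition \<open>\<P>\<close>. It can be infinite, so multiplicities are compared by equipollence.
\<close>
definition pieces ::
    "('i \<Rightarrow> 'w pair_pre_digraph) \<Rightarrow> 'v pair_pre_digraph \<Rightarrow> 'v set set \<Rightarrow> 'i \<Rightarrow> 'v set set" where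
  "pieces S D \<P> i = {P \<in> \<P>. digraph_iso (with_proj (S i)) (with_proj D \<restriction> P)}"

end

theory Submission
  imports Defs
begin

text \<open>
  Since \<open>Q G N = N [G, G]\<close>, the map \<open>Q G\<close> is an idempotent self-map of the normal subgroups, and
  \<open>T\<^sub>G\<close> is its graph; the fibres over the fixed points are looped stars. Every piece of a
  decomposition has a vertex to which all other vertices of the piece point, so no piece can be
  split, and the pieces are determined by the graph.
\<close>

section \<open>Isomorphisms of digraphs without parallel arcs\<close>

text \<open>An arc of a pair digraph is the pair of its ends, so the vertex map determines the arc
  map; this removes arc, head and tail maps from later arguments.\<close>

definition vertex_iso :: "'a pair_pre_digraph \<Rightarrow> 'b pair_pre_digraph \<Rightarrow> ('a \<Rightarrow> 'b) \<Rightarrow> bool" where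
  "vertex_iso A B f \<longleftrightarrow> bij_betw f (pverts A) (pverts B) \<and>
     (\<forall>u\<in>pverts A. \<forall>v\<in>pverts A. (u, v) \<in> parcs A \<longleftrightarrow> (f u, f v) \<in> parcs B)"

abbreviation (input) pair_iso :: "'a pair_pre_digraph \<Rightarrow> 'b pair_pre_digraph \<Rightarrow> bool" where
  "pair_iso A B \<equiv> digraph_iso (with_proj A) (with_proj B)"

text \<open>Keeps induced subgraphs in pair form, so that \<open>vertex_iso\<close> applies to
  them.\<close>

definition induced :: "'a pair_pre_digraph \<Rightarrow> 'a set \<Rightarrow> 'a pair_pre_digraph" where
  "induced D P = \<lparr> pverts = P, parcs = parcs D \<inter> P \<times> P \<rparr>"

lemma pverts_induced [simp]: "pverts (induced D P) = P"
  and parcs_induced [simp]: "parcs (induced D P) = parcs D \<inter> P \<times> P"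
  by (simp_all add: induced_def)

lemma pair_wf_digraph_induced: "pair_wf_digraph (induced D P)"
  by unfold_locales auto

lemma with_proj_restrict: "with_proj D \<restriction> P = with_proj (induced D P)"
  by (auto simp: induce_subgraph_def with_proj_def)

lemma wf_digraph_with_proj_iff: "wf_digraph (with_proj A) \<longleftrightarrow> pair_wf_digraph A"
  by (auto simp: wf_digraph_def pair_wf_digraph_def)

lemma pair_iso_vertex_iso:
  assumes "pair_iso A B"
  obtains f where "vertex_iso A B f"
proof -
  obtain h where h: "pre_digraph.digraph_isomorphism (with_proj A) h"
      and eq: "with_proj B = app_iso h (with_proj A)"
    using assms by (auto simp: digraph_iso_def)
  have inj: "inj_on (iso_verts h) (pverts A)"
    and arc: "\<And>u v. (u, v) \<in> parcs A \<Longrightarrow>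
      iso_verts h u = iso_tail h (iso_arcs h (u, v)) \<and> iso_verts h v = iso_head h (iso_arcs h (u, v))"
    and wf: "pair_wf_digraph A"
    using h by (force simp: pre_digraph.digraph_isomorphism_def wf_digraph_with_proj_iff)+
  \<comment> \<open>The head and tail maps of \<open>with_proj B\<close> are the projections, so
    comparing the record fields forces \<open>iso_arcs h\<close> to act on arcs through
    \<open>iso_verts h\<close>.\<close>
  have B: "pverts B = iso_verts h ` pverts A" "parcs B = iso_arcs h ` parcs A"
      "iso_tail h = fst" "iso_head h = snd"
    using arg_cong[OF eq, of verts] arg_cong[OF eq, of arcs]
      arg_cong[OF eq, of tail] arg_cong[OF eq, of head] by auto
  have arcs: "iso_arcs h (u, v) = (iso_verts h u, iso_verts h v)" if "(u, v) \<in> parcs A" for u v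
    using arc[OF that] B by (simp add: prod_eq_iff)
  have "(u, v) \<in> parcs A \<longleftrightarrow> (iso_verts h u, iso_verts h v) \<in> parcs B"
    if uv: "u \<in> pverts A" "v \<in> pverts A" for u v
  proof
    assume "(iso_verts h u, iso_verts h v) \<in> parcs B"
    then obtain a b where ab: "(a, b) \<in> parcs A" "(iso_verts h u, iso_verts h v) = iso_arcs h (a, b)"
      using B by auto
    moreover have "a \<in> pverts A" "b \<in> pverts A"
      using pair_wf_digraph.wellformed'[OF wf ab(1)] by auto
    ultimately show "(u, v) \<in> parcs A"
      using arcs[OF ab(1)] inj_onD[OF inj] uv by auto
  qed (auto simp: B(2) arcs intro: rev_image_eqI)
  then have "vertex_iso A B (iso_verts h)"
    using inj B(1) by (auto simp: vertex_iso_def bij_betw_def)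
  then show thesis by (rule that)
qed

text \<open>The arc map is \<open>map_prod f f\<close>. As \<open>vertex_iso\<close> only speaks of
  pairs of vertices, well-formedness brings in all arcs of both graphs.\<close>

lemma vertex_iso_pair_iso:
  assumes "vertex_iso A B f" "pair_wf_digraph A" "pair_wf_digraph B"
  shows "pair_iso A B"
proof -
  let ?h = "\<lparr> iso_verts = f, iso_arcs = map_prod f f, iso_head = snd, iso_tail = fst \<rparr>"
  have f: "inj_on f (pverts A)" "f ` pverts A = pverts B"
    and arc: "\<And>u v. u \<in> pverts A \<Longrightarrow> v \<in> pverts A \<Longrightarrow> (u, v) \<in> parcs A \<longleftrightarrow> (f u, f v) \<in> parcs B"
    using assms(1) by (auto simp: vertex_iso_def bij_betw_def)
  have sub: "parcs A \<subseteq> pverts A \<times> pverts A" "parcs B \<subseteq> pverts B \<times> pverts B"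
    using assms(2,3) by (auto dest: pair_wf_digraph.wellformed')
  have "parcs B = map_prod f f ` parcs A"
  proof
    show "map_prod f f ` parcs A \<subseteq> parcs B"
      using sub(1) arc by fastforce
    show "parcs B \<subseteq> map_prod f f ` parcs A"
    proof (rule subrelI)
      fix x y assume xy: "(x, y) \<in> parcs B"
      then obtain u v where uv: "u \<in> pverts A" "v \<in> pverts A" "x = f u" "y = f v"
        using sub(2) f(2) by blast
      then have "(u, v) \<in> parcs A"
        using xy arc by simp
      then show "(x, y) \<in> map_prod f f ` parcs A"
        using uv by force
    qed
  qed
  then have "with_proj B = app_iso ?h (with_proj A)"
    using f by (simp add: app_iso_def with_proj_def)
  moreover have "inj_on (map_prod f f) (parcs A)"
    using map_prod_inj_on[OF f(1) f(1)] sub(1) by (rule inj_on_subset)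
  then have "pre_digraph.digraph_isomorphism (with_proj A) ?h"
    using f(1) assms(2) by (auto simp: pre_digraph.digraph_isomorphism_def wf_digraph_with_proj_iff)
  ultimately show ?thesis
    unfolding digraph_iso_def by blast
qed

lemma pair_iso_sym:
  assumes "pair_iso A B"
  shows "pair_iso B A"
proof -
  have "wf_digraph (with_proj A)"
    using assms by (auto simp: digraph_iso_def pre_digraph.digraph_isomorphism_def)
  then show ?thesis
    using assms by (rule digraph_iso_swap)
qed

lemma pair_iso_cong_right:
  assumes "pair_iso B C"
  shows "pair_iso A B \<longleftrightarrow> pair_iso A C"
proof
  show "pair_iso A C" if "pair_iso A B"
    using that assms by (rule digraph_iso_trans)
  show "pair_iso A B" if "pair_iso A C"
    using that pair_iso_sym[OF assms] by (rule digraph_iso_trans)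
qed

lemma vertex_iso_induced:
  assumes "vertex_iso D D' f" "P \<subseteq> pverts D"
  shows "pair_iso (induced D P) (induced D' (f ` P))"
proof (rule vertex_iso_pair_iso[OF _ pair_wf_digraph_induced pair_wf_digraph_induced])
  show "vertex_iso (induced D P) (induced D' (f ` P)) f"
    using assms by (auto simp: vertex_iso_def bij_betw_def intro: inj_on_subset)
qed

section \<open>Decompositions into pieces with a sink\<close>

text \<open>The property common to looped stars and isolated points that keeps a piece from being
  split. The case \<open>v = c\<close> leaves open whether \<open>c\<close> carries a loop.\<close>

definition has_sink :: "'a pair_pre_digraph \<Rightarrow> bool" where
  "has_sink A \<longleftrightarrow> (\<exists>c\<in>pverts A. \<forall>v\<in>pverts A. v = c \<or> (v, c) \<in> parcs A)"

lemma has_sink_pair_iso: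
  assumes "pair_iso A B" "has_sink A"
  shows "has_sink B"
proof -
  obtain f where "vertex_iso A B f"
    using assms(1) by (rule pair_iso_vertex_iso)
  then show ?thesis
    using assms(2) unfolding has_sink_def vertex_iso_def bij_betw_def by (metis image_iff)
qed

text \<open>What remains of \<open>disjoint_copies\<close> once the models are forgotten; it treats
  both index systems at once.\<close>

definition sink_partition :: "'a pair_pre_digraph \<Rightarrow> 'a set set \<Rightarrow> bool" where
  "sink_partition D \<P> \<longleftrightarrow> partition_on (pverts D) \<P> \<and>
     (\<forall>(u, v) \<in> parcs D. \<exists>P\<in>\<P>. u \<in> P \<and> v \<in> P) \<and> (\<forall>P\<in>\<P>. has_sink (induced D P))"

text \<open>Let \<open>R\<close> be the piece of \<open>\<Q>\<close> containing the sink of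
  \<open>P\<close>. Each other vertex of \<open>P\<close> has an arc to the sink, and no arc leaves
  a piece of \<open>\<Q>\<close>, so it lies in \<open>R\<close> too.\<close>

lemma sink_partition_refines:
  assumes "sink_partition D \<P>" "sink_partition D \<Q>" "P \<in> \<P>"
  shows "\<exists>R\<in>\<Q>. P \<subseteq> R"
proof -
  obtain c where c: "c \<in> P" and arc: "\<And>v. v \<in> P \<Longrightarrow> v = c \<or> (v, c) \<in> parcs D"
    using assms by (auto simp: sink_partition_def has_sink_def)
  have Q: "\<Union>\<Q> = pverts D" "\<Union>\<P> = pverts D" "disjoint \<Q>"
    using assms by (auto simp: sink_partition_def partition_on_def)
  then obtain R where R: "R \<in> \<Q>" "c \<in> R"
    using c assms(3) by blast
  have "v \<in> R" if v: "v \<in> P" for v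
  proof (cases "v = c")
    case False
    then obtain R' where "R' \<in> \<Q>" "v \<in> R'" "c \<in> R'"
      using arc[OF v] assms(2) by (auto simp: sink_partition_def)
    then show ?thesis
      using R Q(3) disjointD by blast
  qed (use R in simp)
  then show ?thesis
    using R by blast
qed

lemma sink_partition_unique:
  assumes "sink_partition D \<P>" "sink_partition D \<Q>"
  shows "\<P> = \<Q>"
proof -
  have sub: "\<P> \<subseteq> \<Q>" if parts: "sink_partition D \<P>" "sink_partition D \<Q>" for \<P> \<Q>
  proof
    fix P assume P: "P \<in> \<P>"
    obtain R where R: "R \<in> \<Q>" "P \<subseteq> R"
      using sink_partition_refines[OF parts P] by blast
    obtain P' where P': "P' \<in> \<P>" "R \<subseteq> P'"
      using sink_partition_refines[OF parts(2,1) R(1)] by blast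
    have "disjoint \<P>" "{} \<notin> \<P>"
      using parts(1) by (auto simp: sink_partition_def partition_on_def)
    moreover have "P \<subseteq> P'"
      using R P' by blast
    \<comment> \<open>The nonempty set \<open>P\<close> lies in \<open>P'\<close>, so the two
      members of \<open>\<P>\<close> meet; hence \<open>P \<subseteq> R \<subseteq> P'\<close>
      collapses to equalities.\<close>
    ultimately have "P = P'"
      using P P' disjointD by (metis inf.orderE)
    then show "P \<in> \<Q>"
      using R P' by auto
  qed
  show ?thesis
    using sub assms by blast
qed

lemma sink_partition_pair_wf_digraph:
  assumes "sink_partition D \<P>"
  shows "pair_wf_digraph D"
  using assms by unfold_locales (fastforce simp: sink_partition_def partition_on_def)+

lemma sink_partition_image:
  assumes f: "vertex_iso D D' f" and P: "sink_partition D \<P>" and wf: "pair_wf_digraph D'"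
  shows "sink_partition D' ((`) f ` \<P>)"
  unfolding sink_partition_def
proof (intro conjI ballI)
  have inj: "inj_on f (pverts D)" "f ` pverts D = pverts D'"
    using f by (auto simp: vertex_iso_def bij_betw_def)
  have part: "partition_on (pverts D) \<P>"
    using P by (simp add: sink_partition_def)
  have "{} \<notin> (`) f ` \<P>"
    using part by (auto simp: partition_on_def)
  then show "partition_on (pverts D') ((`) f ` \<P>)"
    using partition_on_inj_image[OF part inj(1)] inj(2) by simp
  fix e assume e: "e \<in> parcs D'"
  obtain x y where [simp]: "e = (x, y)"
    by (cases e)
  \<comment> \<open>Well-formedness of \<open>D'\<close> puts both ends in the image of
    \<open>f\<close>, so the arc can be pulled back to \<open>D\<close>.\<close>
  have "x \<in> f ` pverts D" "y \<in> f ` pverts D"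
    using e pair_wf_digraph.wellformed'[OF wf] inj(2) by auto
  then obtain u v where uv: "u \<in> pverts D" "v \<in> pverts D" "x = f u" "y = f v"
    by blast
  then have "(u, v) \<in> parcs D"
    using e f by (simp add: vertex_iso_def)
  then obtain P' where "P' \<in> \<P>" "u \<in> P'" "v \<in> P'"
    using P by (auto simp: sink_partition_def)
  then show "case e of (u, v) \<Rightarrow> \<exists>P\<in>(`) f ` \<P>. u \<in> P \<and> v \<in> P"
    using uv by auto
next
  fix R assume "R \<in> (`) f ` \<P>"
  then obtain P' where P': "P' \<in> \<P>" "R = f ` P'"
    by blast
  then have "P' \<subseteq> pverts D" "has_sink (induced D P')"
    using P by (auto simp: sink_partition_def partition_on_def)
  then show "has_sink (induced D' R)"
    using vertex_iso_induced[OF f] has_sink_pair_iso P'(2) by blast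
qed

lemma disjoint_copies_sink_partition:
  assumes "disjoint_copies S I D \<P>" "\<And>i. i \<in> I \<Longrightarrow> has_sink (S i)"
  shows "sink_partition D \<P>"
  using assms has_sink_pair_iso unfolding disjoint_copies_def sink_partition_def with_proj_restrict
  by blast

section \<open>Gluing isomorphisms of pieces\<close>

text \<open>On both sides every arc stays inside one piece, so isomorphisms chosen piece by piece
  fit together to one of the whole graphs.\<close>

lemma pair_iso_glue:
  assumes P: "sink_partition D \<P>" and Q: "sink_partition D' \<Q>" and F: "bij_betw F \<P> \<Q>"
    and iso: "\<And>P. P \<in> \<P> \<Longrightarrow> pair_iso (induced D P) (induced D' (F P))"
  shows "pair_iso D D'"
proof -
  have DP: "\<Union>\<P> = pverts D" "disjoint \<P>" and DQ: "\<Union>\<Q> = pverts D'" "disjoint \<Q>"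
    using P Q by (auto simp: sink_partition_def partition_on_def)
  have "\<exists>h. vertex_iso (induced D P) (induced D' (F P)) h" if "P \<in> \<P>" for P
    using iso[OF that] pair_iso_vertex_iso by blast
  then obtain h where h: "\<And>P. P \<in> \<P> \<Longrightarrow> vertex_iso (induced D P) (induced D' (F P)) (h P)"
    by metis
  then have hb: "bij_betw (h P) P (F P)" if "P \<in> \<P>" for P
    using that by (auto simp: vertex_iso_def)
  have "\<exists>P. P \<in> \<P> \<and> v \<in> P" if "v \<in> pverts D" for v
    using that DP(1) by auto
  then obtain p where p: "\<And>v. v \<in> pverts D \<Longrightarrow> p v \<in> \<P> \<and> v \<in> p v"
    by metis
  have p_eq: "p v = P" if "P \<in> \<P>" "v \<in> P" for v P
    using p[of v] that DP disjointD by blast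
  define f where "f v = h (p v) v" for v
  have f_eq: "f v = h P v" if "P \<in> \<P>" "v \<in> P" for v P
    using p_eq[OF that] by (simp add: f_def)
  have f_in: "f v \<in> F P" if "P \<in> \<P>" "v \<in> P" for v P
    using f_eq[OF that] bij_betwE[OF hb[OF that(1)]] that(2) by simp
  have FQ: "F P \<in> \<Q>" if "P \<in> \<P>" for P
    using F that by (auto simp: bij_betw_def)
  \<comment> \<open>Images in a common piece \<open>R\<close> force
    \<open>F (p u) = R = F (p v)\<close>, and \<open>F\<close> is injective. This gives injectivity
    of \<open>f\<close> and reflects arcs from \<open>D'\<close> to \<open>D\<close>.\<close>
  have same: "p u = p v" if "u \<in> pverts D" "v \<in> pverts D" "R \<in> \<Q>" "f u \<in> R" "f v \<in> R" for u v R
  proof -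
    have "F (p u) = R" "F (p v) = R"
      using that p f_in FQ DQ(2) disjointD by (metis disjoint_iff)+
    then show ?thesis
      using p that F by (metis bij_betw_imp_inj_on inj_onD)
  qed
  have "vertex_iso D D' f"
    unfolding vertex_iso_def bij_betw_def
  proof (intro conjI ballI)
    show "inj_on f (pverts D)"
    proof (rule inj_onI)
      fix u v assume uv: "u \<in> pverts D" "v \<in> pverts D" "f u = f v"
      then have "p u = p v"
        using same[OF uv(1,2), of "F (p u)"] p FQ f_in by metis
      then show "u = v"
        using uv p hb unfolding f_def bij_betw_def by (metis inj_onD)
    qed
    show "f ` pverts D = pverts D'"
    proof
      show "f ` pverts D \<subseteq> pverts D'"
        using p f_in FQ DQ(1) by blast
      show "pverts D' \<subseteq> f ` pverts D"
      proof
        fix x assume "x \<in> pverts D'"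
        then obtain R where "R \<in> \<Q>" "x \<in> R"
          using DQ(1) by blast
        then obtain P where P: "P \<in> \<P>" "x \<in> F P"
          using F by (auto simp: bij_betw_def)
        then obtain v where v: "v \<in> P" "x = h P v"
          using hb[OF P(1)] by (auto simp: bij_betw_def)
        then have "x = f v" "v \<in> pverts D"
          using f_eq[OF P(1)] P(1) DP(1) by auto
        then show "x \<in> f ` pverts D"
          by blast
      qed
    qed
    fix u v assume uv: "u \<in> pverts D" "v \<in> pverts D"
    have iff: "(u, v) \<in> parcs D \<longleftrightarrow> (f u, f v) \<in> parcs D'" if "p u = p v"
    proof -
      have uvp: "p u \<in> \<P>" "u \<in> p u" "v \<in> p u"
        using p uv that by auto
      then show ?thesis
        using h[OF uvp(1)] f_in[OF uvp(1)] f_eq[OF uvp(1)] by (simp add: vertex_iso_def)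
    qed
    show "(u, v) \<in> parcs D \<longleftrightarrow> (f u, f v) \<in> parcs D'"
    proof
      assume uvD: "(u, v) \<in> parcs D"
      then obtain P' where "P' \<in> \<P>" "u \<in> P'" "v \<in> P'"
        using P by (auto simp: sink_partition_def)
      then show "(f u, f v) \<in> parcs D'"
        using iff uvD p_eq by metis
    next
      assume uvD: "(f u, f v) \<in> parcs D'"
      then obtain R where "R \<in> \<Q>" "f u \<in> R" "f v \<in> R"
        using Q by (auto simp: sink_partition_def)
      then show "(u, v) \<in> parcs D"
        using iff uvD same uv by blast
    qed
  qed
  then show ?thesis
    using sink_partition_pair_wf_digraph[OF P] sink_partition_pair_wf_digraph[OF Q]
    by (rule vertex_iso_pair_iso)
qed

section \<open>Multiplicities as a complete invariant\<close>

lemma pieces_eq: "pieces S D \<P> i = {P \<in> \<P>. pair_iso (S i) (induced D P)}"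
  by (simp add: pieces_def with_proj_restrict)

text \<open>By uniqueness of the decomposition, an isomorphism carries \<open>\<P>\<close> exactly
  onto \<open>\<Q>\<close>; taking images is then a bijection of pieces that preserves their
  isomorphism types.\<close>

lemma pieces_eqpoll_if_pair_iso:
  assumes "pair_iso D D'" and P: "sink_partition D \<P>" and Q: "sink_partition D' \<Q>"
  shows "pieces U D \<P> k \<approx> pieces U D' \<Q> k"
proof -
  obtain f where f: "vertex_iso D D' f"
    using assms(1) by (rule pair_iso_vertex_iso)
  have img: "(`) f ` \<P> = \<Q>"
    using sink_partition_image[OF f P sink_partition_pair_wf_digraph[OF Q]] Q
    by (rule sink_partition_unique)
  have sub: "P \<subseteq> pverts D" if "P \<in> \<P>" for P
    using that P by (auto simp: sink_partition_def partition_on_def)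
  have "inj_on ((`) f) (Pow (pverts D))"
    using f by (auto simp: vertex_iso_def bij_betw_def intro: inj_on_image_Pow)
  then have "inj_on ((`) f) (pieces U D \<P> k)"
    by (rule inj_on_subset) (use sub in \<open>auto simp: pieces_def\<close>)
  moreover have "(`) f ` pieces U D \<P> k = pieces U D' \<Q> k"
  proof -
    have "pair_iso (U k) (induced D P) \<longleftrightarrow> pair_iso (U k) (induced D' (f ` P))" if "P \<in> \<P>" for P
      using vertex_iso_induced[OF f sub[OF that]] by (rule pair_iso_cong_right)
    then show ?thesis
      unfolding pieces_eq img[symmetric] by auto
  qed
  ultimately show ?thesis
    by (auto simp: eqpoll_def bij_betw_def)
qed

text \<open>The bijections given for the single indices are merged into one bijection
  \<open>F\<close> that matches isomorphic pieces, and the isomorphisms are glued.\<close>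

lemma pair_iso_if_pieces_eqpoll:
  assumes P: "sink_partition D \<P>" and Q: "sink_partition D' \<Q>"
    and UP: "\<And>P. P \<in> \<P> \<Longrightarrow> \<exists>k\<in>K. pair_iso (U k) (induced D P)"
    and UQ: "\<And>R. R \<in> \<Q> \<Longrightarrow> \<exists>k\<in>K. pair_iso (U k) (induced D' R)"
    and eq: "\<And>k. k \<in> K \<Longrightarrow> pieces U D \<P> k \<approx> pieces U D' \<Q> k"
  shows "pair_iso D D'"
proof -
  obtain g where g: "\<And>k. k \<in> K \<Longrightarrow> bij_betw (g k) (pieces U D \<P> k) (pieces U D' \<Q> k)"
    using eq unfolding eqpoll_def by metis
  define a where "a P = {k \<in> K. pair_iso (U k) (induced D P)}" for P
  define b where "b R = {k \<in> K. pair_iso (U k) (induced D' R)}" for R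
  \<comment> \<open>Several indices can describe the same piece; \<open>F\<close> must use only one of them.\<close>
  define F where "F P = g (SOME k. k \<in> a P) P" for P
  have iso: "pair_iso (induced D P) (induced D' R)" if "k \<in> a P" "k \<in> b R" for k P R
    using that pair_iso_sym digraph_iso_trans unfolding a_def b_def by blast
  \<comment> \<open>One shared index makes the pieces isomorphic, hence all their indices agree, and
    \<open>SOME\<close> picks the same index for both.\<close>
  have ab: "a P = b R" if "k \<in> a P" "k \<in> b R" for k P R
    by (simp add: a_def b_def pair_iso_cong_right[OF iso[OF that]])
  have chosen: "(SOME k. k \<in> a P) \<in> a P" if "P \<in> \<P>" for P
    using UP[OF that] by (subst some_in_eq) (auto simp: a_def)
  have chosen': "(SOME k. k \<in> b R) \<in> b R" if "R \<in> \<Q>" for R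
    using UQ[OF that] by (subst some_in_eq) (auto simp: b_def)
  have mem: "P \<in> pieces U D \<P> k" if "P \<in> \<P>" "k \<in> a P" for P k
    using that by (simp add: a_def pieces_eq)
  have F: "F P \<in> \<Q> \<and> (SOME k. k \<in> a P) \<in> b (F P)" if "P \<in> \<P>" for P
  proof -
    have k: "(SOME k. k \<in> a P) \<in> K"
      using chosen[OF that] by (simp add: a_def)
    then have "F P \<in> pieces U D' \<Q> (SOME k. k \<in> a P)"
      using g[OF k] mem[OF that chosen[OF that]] by (auto simp: F_def dest: bij_betwE)
    then show ?thesis
      using k by (simp add: pieces_eq b_def)
  qed
  have "bij_betw F \<P> \<Q>"
    unfolding bij_betw_def
  proof
    show "inj_on F \<P>"
    proof (rule inj_onI)
      fix P P' assume PP: "P \<in> \<P>" "P' \<in> \<P>" "F P = F P'"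
      \<comment> \<open>Both sets equal \<open>b (F P)\<close>, so \<open>P\<close> and
        \<open>P'\<close> are mapped by the same bijection \<open>g k\<close>.\<close>
      have aa: "a P = a P'"
        using PP ab chosen F by metis
      have k: "(SOME k. k \<in> a P) \<in> K"
        using chosen[OF PP(1)] by (simp add: a_def)
      have "P \<in> pieces U D \<P> (SOME k. k \<in> a P)" "P' \<in> pieces U D \<P> (SOME k. k \<in> a P)"
        using mem chosen PP(1,2) aa by auto
      then show "P = P'"
        using bij_betw_imp_inj_on[OF g[OF k]] PP(3) aa unfolding F_def by (auto dest: inj_onD)
    qed
    have "R \<in> F ` \<P>" if R: "R \<in> \<Q>" for R
    proof -
      \<comment> \<open>A preimage \<open>P\<close> of \<open>R\<close> under \<open>g k\<close> has
        \<open>a P = b R\<close>, so \<open>k\<close> is also the index chosen for \<open>P\<close>,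
        and \<open>F P = g k P\<close>.\<close>
      define k where "k = (SOME k. k \<in> b R)"
      have k: "k \<in> b R" "k \<in> K"
        using chosen'[OF R] by (simp_all add: k_def b_def)
      then have "R \<in> g k ` pieces U D \<P> k"
        using R bij_betw_imp_surj_on[OF g[OF k(2)]] by (simp add: b_def pieces_eq[of U D'])
      then obtain P where P: "P \<in> pieces U D \<P> k" "g k P = R"
        by blast
      then have "k \<in> a P" "P \<in> \<P>"
        using k by (auto simp: a_def pieces_eq)
      then have "F P = R"
        using ab[OF \<open>k \<in> a P\<close> k(1)] P(2) by (simp add: F_def k_def)
      then show ?thesis
        using \<open>P \<in> \<P>\<close> by blast
    qed
    then show "F ` \<P> = \<Q>"
      using F by blast
  qed
  then show ?thesis
    by (rule pair_iso_glue[OF P Q]) (use iso chosen F in blast)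
qed

text \<open>The decompositions may use models indexed by different types. The family
  \<open>U\<close> represents the models of both, so that multiplicities are compared over one index
  set.\<close>

lemma pair_iso_iff_pieces_eqpoll:
  assumes P: "disjoint_copies S I D \<P>" and Q: "disjoint_copies T J D' \<Q>"
    and sinks: "\<And>i. i \<in> I \<Longrightarrow> has_sink (S i)" "\<And>j. j \<in> J \<Longrightarrow> has_sink (T j)"
    and US: "\<And>i. i \<in> I \<Longrightarrow> \<exists>k\<in>K. pair_iso (U k) (S i)"
    and UT: "\<And>j. j \<in> J \<Longrightarrow> \<exists>k\<in>K. pair_iso (U k) (T j)"
  shows "pair_iso D D' \<longleftrightarrow> (\<forall>k\<in>K. pieces U D \<P> k \<approx> pieces U D' \<Q> k)"
proof
  have sP: "sink_partition D \<P>" and sQ: "sink_partition D' \<Q>"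
    using disjoint_copies_sink_partition P Q sinks by blast+
  show "\<forall>k\<in>K. pieces U D \<P> k \<approx> pieces U D' \<Q> k" if "pair_iso D D'"
    by (intro ballI pieces_eqpoll_if_pair_iso[OF that sP sQ])
  show "pair_iso D D'" if eq: "\<forall>k\<in>K. pieces U D \<P> k \<approx> pieces U D' \<Q> k"
  proof (rule pair_iso_if_pieces_eqpoll[OF sP sQ])
    show "\<exists>k\<in>K. pair_iso (U k) (induced D P)" if "P \<in> \<P>" for P
      using P US that digraph_iso_trans unfolding disjoint_copies_def with_proj_restrict by metis
    show "\<exists>k\<in>K. pair_iso (U k) (induced D' R)" if "R \<in> \<Q>" for R
      using Q UT that digraph_iso_trans unfolding disjoint_copies_def with_proj_restrict by metis
  qed (use eq in blast)
qed

section \<open>Looped stars and graphs of idempotent maps\<close>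

lemma pair_wf_digraph_looped_star: "pair_wf_digraph (looped_star J)"
  by unfold_locales (auto simp: looped_star_def)

lemma pair_wf_digraph_isolated_point: "pair_wf_digraph isolated_point"
  by unfold_locales (auto simp: isolated_point_def)

lemma has_sink_looped_star: "has_sink (looped_star J)"
  by (auto simp: has_sink_def looped_star_def)

lemma has_sink_isolated_point: "has_sink isolated_point"
  by (auto simp: has_sink_def isolated_point_def)

lemma has_sink_cstar: "has_sink (cstar k)"
  by (simp add: cstar_def has_sink_looped_star has_sink_isolated_point split: option.split)

lemma has_sink_zstar: "has_sink (zstar j)"
  by (simp add: zstar_def has_sink_looped_star has_sink_isolated_point)

lemma pair_iso_looped_star:
  assumes "bij_betw f J J'"
  shows "pair_iso (looped_star J) (looped_star J')"
proof (rule vertex_iso_pair_iso[OF _ pair_wf_digraph_looped_star pair_wf_digraph_looped_star])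
  show "vertex_iso (looped_star J) (looped_star J') (map_option f)"
    using assms by (auto simp: vertex_iso_def bij_betw_def inj_on_def looped_star_def image_image)
qed

lemma pair_iso_isolated_point:
  "pair_iso (isolated_point :: 'i option pair_pre_digraph) (isolated_point :: 'j option pair_pre_digraph)"
proof (rule vertex_iso_pair_iso[OF _ pair_wf_digraph_isolated_point pair_wf_digraph_isolated_point])
  show "vertex_iso (isolated_point :: 'i option pair_pre_digraph)
      (isolated_point :: 'j option pair_pre_digraph) (\<lambda>_. None)"
    by (simp add: vertex_iso_def bij_betw_def isolated_point_def)
qed

lemma pair_iso_refl: "pair_wf_digraph A \<Longrightarrow> pair_iso A A"
  by (rule vertex_iso_pair_iso[of _ _ id]) (auto simp: vertex_iso_def)

lemma pair_iso_zstar_refl: "pair_iso (zstar j) (zstar j)"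
  by (simp add: zstar_def pair_iso_refl pair_wf_digraph_looped_star pair_wf_digraph_isolated_point)

text \<open>Serves to move an index into a larger type without changing the graph it
  describes.\<close>

lemma pair_iso_cstar_image:
  assumes "inj f"
  shows "pair_iso (cstar (map_option ((`) f) k)) (cstar k)"
proof (cases k)
  case None
  then show ?thesis
    by (simp add: cstar_def pair_iso_isolated_point)
next
  case (Some J)
  have "bij_betw f J (f ` J)"
    using assms by (auto simp: bij_betw_def intro: inj_on_subset)
  then show ?thesis
    using Some by (auto simp: cstar_def intro: pair_iso_sym pair_iso_looped_star)
qed

section \<open>Decomposition of the graph of an idempotent map\<close>

text \<open>The pieces are the fibres of \<open>q\<close>. Each contains its value \<open>c\<close>,
  which is fixed and so carries the loop, while the other elements are leaves pointing to
  \<open>c\<close>.\<close>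

lemma disjoint_copies_idempotent:
  assumes V: "pverts D = V" and arcs: "parcs D = {(v, q v) |v. v \<in> V}"
    and q: "\<And>v. v \<in> V \<Longrightarrow> q v \<in> V" "\<And>v. v \<in> V \<Longrightarrow> q (q v) = q v"
    and S: "\<And>c. c \<in> V \<Longrightarrow> q c = c \<Longrightarrow> \<exists>i\<in>I. pair_iso (S i) (looped_star {v \<in> V. q v = c \<and> v \<noteq> c})"
  shows "\<exists>\<P>. disjoint_copies S I D \<P>"
proof
  let ?P = "\<lambda>c. {v \<in> V. q v = c}"
  show "disjoint_copies S I D (?P ` q ` V)"
    unfolding disjoint_copies_def with_proj_restrict
  proof (intro conjI ballI)
    show "partition_on (pverts D) (?P ` q ` V)"
      by (rule partition_onI) (auto simp: V disjnt_def)
    show "case e of (u, v) \<Rightarrow> \<exists>P\<in>?P ` q ` V. u \<in> P \<and> v \<in> P" if "e \<in> parcs D" for e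
      using that q by (auto simp: arcs)
    fix P assume "P \<in> ?P ` q ` V"
    then obtain c where c: "c \<in> V" "q c = c" "P = ?P c"
      using q by force
    \<comment> \<open>The map \<open>case_option c id\<close> sends the center to \<open>c\<close>
      and each leaf to itself.\<close>
    have "vertex_iso (looped_star {v \<in> V. q v = c \<and> v \<noteq> c}) (induced D P) (case_option c id)"
      using c by (auto simp: vertex_iso_def looped_star_def arcs bij_betw_def inj_on_def image_iff)
    then have "pair_iso (looped_star {v \<in> V. q v = c \<and> v \<noteq> c}) (induced D P)"
      using pair_wf_digraph_looped_star pair_wf_digraph_induced by (rule vertex_iso_pair_iso)
    then show "\<exists>i\<in>I. pair_iso (S i) (induced D P)"
      using S[OF c(1,2)] digraph_iso_trans by blast
  qed
qed

section \<open>The map Q\<close>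

text \<open>The quotient map is onto, so it carries \<open>[G, G]\<close> onto the derived subgroup
  of the quotient; the preimage is the union of the cosets of \<open>N\<close> that meet
  \<open>[G, G]\<close>.\<close>

lemma (in group) Q_eq_set_mult:
  assumes "N \<lhd> G"
  shows "Q G N = N <#> derived G (carrier G)"
proof -
  interpret N: normal N G
    by (rule assms)
  interpret h: group_hom G "G Mod N" "\<lambda>x. N #> x"
    using N.r_coset_hom_Mod N.factorgroup_is_group is_group
    by (simp add: group_hom_def group_hom_axioms_def)
  have sub: "derived G (carrier G) \<subseteq> carrier G"
    by (rule derived_in_carrier) simp
  have D: "derived (G Mod N) (carrier (G Mod N)) = (\<lambda>x. N #> x) ` derived G (carrier G)"
    using h.derived_img[of "carrier G"] by (simp add: carrier_FactGroup)
  have "Q G N = (\<Union>d\<in>derived G (carrier G). N #> d)"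
  proof
    show "Q G N \<subseteq> (\<Union>d\<in>derived G (carrier G). N #> d)"
    proof
      fix x assume "x \<in> Q G N"
      then have "x \<in> N #> x" "N #> x \<in> (\<lambda>x. N #> x) ` derived G (carrier G)"
        using rcos_self[OF _ N.subgroup_axioms] unfolding Q_def D by auto
      then show "x \<in> (\<Union>d\<in>derived G (carrier G). N #> d)"
        by auto
    qed
    show "(\<Union>d\<in>derived G (carrier G). N #> d) \<subseteq> Q G N"
    proof
      fix x assume "x \<in> (\<Union>d\<in>derived G (carrier G). N #> d)"
      then obtain d where d: "d \<in> derived G (carrier G)" "x \<in> N #> d"
        by blast
      \<comment> \<open>Any element of a coset represents it, so the coset of \<open>x\<close> is
        that of \<open>d\<close>.\<close>
      then have "x \<in> carrier G" "N #> d = N #> x"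
        using sub r_coset_subset_G[OF N.subset] repr_independence[OF _ _ N.subgroup_axioms] by blast+
      then show "x \<in> Q G N"
        using d(1) unfolding Q_def D by blast
    qed
  qed
  also have "\<dots> = N <#> derived G (carrier G)"
    by (auto simp: set_mult_def r_coset_def)
  finally show ?thesis .
qed

lemma (in group) Q_normal:
  assumes "N \<lhd> G"
  shows "Q G N \<lhd> G"
  using normal_subgroup_set_mult_closed[OF assms derived_self_is_normal]
  by (simp add: Q_eq_set_mult[OF assms])

text \<open>The second factor \<open>[G, G]\<close> is absorbed, because a subgroup multiplied by
  itself is itself.\<close>

lemma (in group) Q_idem:
  assumes "N \<lhd> G"
  shows "Q G (Q G N) = Q G N"
proof -
  let ?D = "derived G (carrier G)"
  have "Q G (Q G N) = (N <#> ?D) <#> ?D"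
    using Q_eq_set_mult[OF Q_normal[OF assms]] Q_eq_set_mult[OF assms] by simp
  also have "\<dots> = N <#> (?D <#> ?D)"
    using normal_imp_subgroup[OF assms] derived_in_carrier[of "carrier G"]
    by (intro set_mult_assoc) (auto dest: subgroup.subset)
  also have "?D <#> ?D = ?D"
    by (intro subgroup_mult_id normal_imp_subgroup derived_self_is_normal)
  finally show ?thesis
    using Q_eq_set_mult[OF assms] by simp
qed

section \<open>Decomposition of the property R graph\<close>

text \<open>As \<open>Q G N\<close> is again normal, each vertex has exactly one outgoing arc: the
  graph is that of a self-map.\<close>

lemma (in group) property_R_graph_eq:
  "pverts (property_R_graph G) = {N. N \<lhd> G}"
  "parcs (property_R_graph G) = {(N, Q G N) |N. N \<in> {N. N \<lhd> G}}"
  using Q_normal by (auto simp: property_R_graph_def)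

lemma (in group) property_R_graph_disjoint_copies:
  assumes "\<And>N. N \<lhd> G \<Longrightarrow> Q G N = N \<Longrightarrow>
    \<exists>i\<in>I. pair_iso (S i) (looped_star {M \<in> {N. N \<lhd> G}. Q G M = N \<and> M \<noteq> N})"
  shows "\<exists>\<P>. disjoint_copies S I (property_R_graph G) \<P>"
  using property_R_graph_eq
  by (rule disjoint_copies_idempotent) (use assms Q_normal Q_idem in auto)

theorem theorem4:
  fixes G :: "('a, 'm) monoid_scheme"
  assumes "group G"
  shows
    "(\<exists>\<P>. disjoint_copies (cstar :: 'a set set option \<Rightarrow> _) UNIV (property_R_graph G) \<P>)
     \<and> (\<forall>(H :: ('b, 'n) monoid_scheme) \<P> \<Q>.
          group H
          \<longrightarrow> disjoint_copies (cstar :: 'a set set option \<Rightarrow> _) UNIV (property_R_graph G) \<P>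
          \<longrightarrow> disjoint_copies (cstar :: 'b set set option \<Rightarrow> _) UNIV (property_R_graph H) \<Q>
          \<longrightarrow> (digraph_iso (with_proj (property_R_graph G)) (with_proj (property_R_graph H))
               \<longleftrightarrow> (\<forall>k :: ('a set + 'b set) set option.
                     pieces cstar (property_R_graph G) \<P> k
                     \<approx> pieces cstar (property_R_graph H) \<Q> k)))
     \<and> ((\<forall>N. N \<lhd> G \<longrightarrow> finite (in_arcs (with_proj (property_R_graph G)) N))
          \<longrightarrow> (\<exists>\<P>. disjoint_copies zstar {-1..} (property_R_graph G) \<P>))
     \<and> (\<forall>(H :: ('b, 'n) monoid_scheme) \<P> \<Q>.
          group H
          \<longrightarrow> disjoint_copies zstar {-1..} (property_R_graph G) \<P>
          \<longrightarrow> disjoint_copies zstar {-1..} (property_R_graph H) \<Q>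
          \<longrightarrow> (digraph_iso (with_proj (property_R_graph G)) (with_proj (property_R_graph H))
               \<longleftrightarrow> (\<forall>j\<ge>-1. pieces zstar (property_R_graph G) \<P> j
                            \<approx> pieces zstar (property_R_graph H) \<Q> j)))"
proof (intro conjI allI impI)
  interpret G: group G
    by (rule assms)
  let ?T = "property_R_graph G"
  \<comment> \<open>The leaves are subsets of the group, so the set of leaves is itself an index of
    type \<open>'a set set\<close>.\<close>
  have "pair_iso (cstar (Some J)) (looped_star J)" for J :: "'a set set"
    by (simp add: cstar_def pair_iso_refl pair_wf_digraph_looped_star)
  then show "\<exists>\<P>. disjoint_copies (cstar :: 'a set set option \<Rightarrow> _) UNIV ?T \<P>"
    by (intro G.property_R_graph_disjoint_copies) blast
  show "\<exists>\<P>. disjoint_copies zstar {-1..} ?T \<P>"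
    if fin: "\<forall>N. N \<lhd> G \<longrightarrow> finite (in_arcs (with_proj ?T) N)"
  proof (rule G.property_R_graph_disjoint_copies)
    fix N assume N: "N \<lhd> G" "Q G N = N"
    let ?L = "{M \<in> {N. N \<lhd> G}. Q G M = N \<and> M \<noteq> N}"
    \<comment> \<open>Each leaf is the tail of an arc into \<open>N\<close>, so finite in-degree
      bounds the number of leaves.\<close>
    have "?L \<subseteq> fst ` in_arcs (with_proj ?T) N"
    proof
      fix M assume "M \<in> ?L"
      then have "(M, N) \<in> in_arcs (with_proj ?T) N"
        by (auto simp: in_arcs_def G.property_R_graph_eq)
      then show "M \<in> fst ` in_arcs (with_proj ?T) N"
        by (rule rev_image_eqI) simp
    qed
    then have "finite ?L"
      using fin N(1) by (meson finite_imageI finite_subset)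
    then obtain h where "bij_betw h {0..<card ?L} ?L"
      using ex_bij_betw_nat_finite by blast
    then have "pair_iso (zstar (int (card ?L))) (looped_star ?L)"
      by (simp add: zstar_def atLeast0LessThan pair_iso_looped_star)
    then show "\<exists>j\<in>{-1..}. pair_iso (zstar j) (looped_star ?L)"
      by (rule bexI) simp
  qed
next
  fix H :: "('b, 'n) monoid_scheme" and \<P> \<Q>
  assume P: "disjoint_copies (cstar :: 'a set set option \<Rightarrow> _) UNIV (property_R_graph G) \<P>"
    and Q: "disjoint_copies (cstar :: 'b set set option \<Rightarrow> _) UNIV (property_R_graph H) \<Q>"
  \<comment> \<open>The indices for \<open>G\<close> and \<open>H\<close> have different types;
    \<open>Inl\<close> and \<open>Inr\<close> embed both into the sum type.\<close>
  have "\<exists>k\<in>UNIV. pair_iso (cstar (k :: ('a set + 'b set) set option)) (cstar i)"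
    for i :: "'a set set option"
    by (rule bexI[of _ "map_option ((`) Inl) i"]) (simp_all add: pair_iso_cstar_image)
  moreover have "\<exists>k\<in>UNIV. pair_iso (cstar (k :: ('a set + 'b set) set option)) (cstar j)"
    for j :: "'b set set option"
    by (rule bexI[of _ "map_option ((`) Inr) j"]) (simp_all add: pair_iso_cstar_image)
  ultimately show "pair_iso (property_R_graph G) (property_R_graph H) \<longleftrightarrow>
      (\<forall>k :: ('a set + 'b set) set option.
         pieces cstar (property_R_graph G) \<P> k \<approx> pieces cstar (property_R_graph H) \<Q> k)"
    using pair_iso_iff_pieces_eqpoll[OF P Q has_sink_cstar has_sink_cstar,
        where U = "cstar :: ('a set + 'b set) set option \<Rightarrow> _" and K = UNIV] by simp
next
  fix H :: "('b, 'n) monoid_scheme" and \<P> \<Q>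
  assume P: "disjoint_copies zstar {-1..} (property_R_graph G) \<P>"
    and Q: "disjoint_copies zstar {-1..} (property_R_graph H) \<Q>"
  show "pair_iso (property_R_graph G) (property_R_graph H) \<longleftrightarrow>
      (\<forall>j\<ge>-1. pieces zstar (property_R_graph G) \<P> j \<approx> pieces zstar (property_R_graph H) \<Q> j)"
    \<comment> \<open>Here both sides already share the integer indices, so \<open>zstar\<close>
      itself serves as the common family.\<close>
    using pair_iso_iff_pieces_eqpoll[OF P Q has_sink_zstar has_sink_zstar,
        where U = zstar and K = "{-1..}"] pair_iso_zstar_refl by auto
qed

end
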